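(* Let $A_1,\dots,A_n$ be the vertices of a Platonic solid in Euclidean $3$-space ($n=4,6,8,12,20$). For any point $M$ on the circumscribed sphere of the solid, with $d_i=|MA_i|$, $$4\left(\sum_{i=1}^n d_i^2\right)^2=3n\sum_{i=1}^n d_i^4.$$
   Context: The Platonic solid with $n$ vertices is the regular tetrahedron ($n=4$), regular octahedron ($n=6$), cube ($n=8$), regular icosahedron ($n=12$) or regular dodecahedron ($n=20$). $|MA_i|$ denotes Euclidean distance. *)

theory Defs
  imports "HOL-Analysis.Analysis"
begin

definition angle_at :: "'a::real_inner \<Rightarrow> 'a \<Rightarrow> 'a \<Rightarrow> real" where
  "angle_at v a b = arccos (((a - v) \<bullet> (b - v)) / (norm (a - v) * norm (b - v)))"

text \<open>A convex polygon is a polytope of affine dimension 2. In the third and fourth conjuncts,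
  \<open>closed_segment v a edge_of F\<close> forces \<open>v \<noteq> a\<close> and makes both points vertices of \<open>F\<close>;
  two distinct edges sharing the vertex \<open>v\<close> are its only edges there, so their angle is the
  interior angle of \<open>F\<close> at \<open>v\<close>.\<close>

definition regular_polygon :: "'a::euclidean_space set \<Rightarrow> bool" where
  "regular_polygon F \<longleftrightarrow>
     polytope F \<and> aff_dim F = 2 \<and>
     (\<exists>s. \<forall>v a. closed_segment v a edge_of F \<longrightarrow> dist v a = s) \<and>
     (\<exists>\<theta>. \<forall>v a b. closed_segment v a edge_of F \<and> closed_segment v b edge_of F \<and> a \<noteq> b
            \<longrightarrow> angle_at v a b = \<theta>)"

definition congruent_sets :: "'a::metric_space set \<Rightarrow> 'a set \<Rightarrow> bool" where
  "congruent_sets F G \<longleftrightarrow> (\<exists>f. (\<forall>x y. dist (f x) (f y) = dist x y) \<and> f ` F = G)"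

text \<open>The classical definition: a solid convex polyhedron whose faces are mutually congruent
  regular polygons, with the same number of faces meeting at every vertex. The polyhedra
  satisfying it are exactly the regular tetrahedra, octahedra, cubes, icosahedra and dodecahedra.\<close>

definition platonic_solid :: "(real^3) set \<Rightarrow> bool" where
  "platonic_solid P \<longleftrightarrow>
     polytope P \<and> aff_dim P = 3 \<and>
     (\<forall>F. F facet_of P \<longrightarrow> regular_polygon F) \<and>
     (\<forall>F G. F facet_of P \<and> G facet_of P \<longrightarrow> congruent_sets F G) \<and>
     (\<exists>q. \<forall>v. v extreme_point_of P \<longrightarrow> card {F. F facet_of P \<and> v \<in> F} = q)"

definition circumscribed_sphere :: "'a::euclidean_space set \<Rightarrow> 'a \<Rightarrow> real \<Rightarrow> bool" where
  "circumscribed_sphere P c r \<longleftrightarrow> {v. v extreme_point_of P} \<subseteq> sphere c r"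

end

theory Submission
  imports Defs
begin

text \<open>The identity says that the vertices, as vectors \<open>u v\<close> from the centre, sum to zero and have an
  isotropic second moment. No classification of the solids is needed. The neighbours of a vertex
  \<open>v\<close> lie on a circle with axis \<open>u v\<close>, and each neighbour has two others (one in each of its two
  faces at \<open>v\<close>) at a fixed distance, placed symmetrically about it. Averaging over these pairs shows
  that the neighbours of \<open>v\<close> sum to a multiple of \<open>u v\<close> and have a second moment isotropic in the
  plane orthogonal to \<open>u v\<close>. Averaging once more over all vertices, each having \<open>q\<close> neighbours,
  gives linear equations that determine the first and second moments of the whole vertex set.\<close>

subsection \<open>Edges and facets of polytopes\<close>

text \<open>All facets have the same dimension, whereas a proper face of a convex set has strictly
  smaller dimension.\<close>

lemma facet_of_antisym_subset:
  assumes "convex P" "F facet_of P" "G facet_of P" "F \<subseteq> G"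
  shows "F = G"
proof -
  have "F face_of G" "convex G"
    using face_of_face[OF facet_of_imp_face_of[OF assms(3)], of F] assms(2,4) facet_of_imp_face_of
      face_of_imp_convex[OF facet_of_imp_face_of[OF assms(3)]] by auto
  then show ?thesis
    using face_of_aff_dim_lt[of G F] assms(2,3) by (auto simp: facet_of_def)
qed

text \<open>Transversally to \<open>E\<close> the polytope is a planar wedge, bounded by two sides.
  The lemma is applied to a vertex of a polygon and to an edge of a solid.\<close>

lemma polytope_ridge_two_facets:
  fixes P :: "'a::euclidean_space set"
  assumes P: "polytope P" and E: "E face_of P" "E \<noteq> {}" and dim: "aff_dim E = aff_dim P - 2"
  shows "card {F. F facet_of P \<and> E \<subseteq> F} = 2"
proof -
  let ?S = "{F. F facet_of P \<and> E \<subseteq> F}"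
  have cvx: "convex P" and ph: "polyhedron P"
    using P by (auto intro: polytope_imp_convex polytope_imp_polyhedron)
  have EP: "E = \<Inter>?S"
    using face_of_polyhedron[OF ph E] dim by force
  have "E \<noteq> P" using dim by auto
  then obtain F1 where F1: "F1 facet_of P" "E \<subseteq> F1"
    using face_of_polyhedron_subset_facet[OF ph E] by blast
  \<comment> \<open>\<open>E\<close> is the intersection of the facets containing it; were
    \<open>F1\<close> the only one, \<open>E\<close> would have codimension 1.\<close>
  have "?S \<noteq> {F1}" using EP F1 dim by (auto simp: facet_of_def)
  then obtain F2 where F2: "F2 facet_of P" "E \<subseteq> F2" "F1 \<noteq> F2" using F1 by blast
  \<comment> \<open>The slack of a third facet is a nonnegative combination of the slacks of \<open>F1\<close> and \<open>F2\<close>, so a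
    third facet is contained in one of these.\<close>
  have "F3 \<in> {F1, F2}" if F3: "F3 facet_of P" "E \<subseteq> F3" for F3
  proof (rule ccontr)
    assume new: "F3 \<notin> {F1, F2}"
    obtain p where p: "p \<in> F1" "p \<notin> F2"
      using facet_of_antisym_subset[OF cvx F1(1) F2(1)] F2(3) by blast
    obtain q where q: "q \<in> F2" "q \<notin> F1"
      using facet_of_antisym_subset[OF cvx F2(1) F1(1)] F2(3) by blast
    have pq: "p \<in> P" "q \<in> P" using p q F1 F2 facet_of_imp_subset by blast+
    obtain a1 b1 where s1: "P \<subseteq> {x. a1 \<bullet> x \<le> b1}" "F1 = P \<inter> {x. a1 \<bullet> x = b1}"
      using facet_of_polyhedron[OF ph F1(1)] by metis
    obtain a2 b2 where s2: "P \<subseteq> {x. a2 \<bullet> x \<le> b2}" "F2 = P \<inter> {x. a2 \<bullet> x = b2}"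
      using facet_of_polyhedron[OF ph F2(1)] by metis
    obtain a3 b3 where s3: "P \<subseteq> {x. a3 \<bullet> x \<le> b3}" "F3 = P \<inter> {x. a3 \<bullet> x = b3}"
      using facet_of_polyhedron[OF ph F3(1)] by metis
    \<comment> \<open>A face is the trace on \<open>P\<close> of its affine hull. So adjoining
      \<open>p\<close> and then \<open>q\<close> to \<open>E\<close> raises the dimension by one
      each time, and \<open>E\<close>, \<open>p\<close>, \<open>q\<close> together affinely span
      \<open>P\<close>.\<close>
    have "p \<notin> affine hull E"
      using face_of_imp_eq_affine_Int[OF cvx E(1)] p pq F2(2) by blast
    then have d1: "aff_dim (insert p E) = aff_dim P - 1"
      using dim by (simp add: aff_dim_insert)
    have "affine hull (insert p E) \<subseteq> affine hull F1"
      using p F1 by (intro hull_mono) auto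
    moreover have "q \<notin> affine hull F1"
      using face_of_imp_eq_affine_Int[OF cvx facet_of_imp_face_of[OF F1(1)]] q pq by blast
    ultimately have "aff_dim (insert q (insert p E)) = aff_dim P"
      using d1 aff_dim_insert[of q "insert p E"] by auto
    moreover have "insert q (insert p E) \<subseteq> P"
      using pq face_of_imp_subset[OF E(1)] by auto
    ultimately have hull: "affine hull (insert q (insert p E)) = affine hull P"
      using hull_mono[of "insert q (insert p E)" P affine]
      by (intro affine_dim_equal) (simp_all add: aff_dim_affine_hull)
    \<comment> \<open>The slack of \<open>F1\<close> vanishes at \<open>p\<close> and that of
      \<open>F2\<close> at \<open>q\<close>. The coefficients are therefore forced by matching the
      slack of \<open>F3\<close> at these two points; all three slacks vanish on \<open>E\<close>,
      so the match extends to \<open>P\<close>.\<close>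
    define \<alpha> where "\<alpha> = (b3 - a3 \<bullet> p) / (b2 - a2 \<bullet> p)"
    define \<beta> where "\<beta> = (b3 - a3 \<bullet> q) / (b1 - a1 \<bullet> q)"
    define g where "g = a3 - \<alpha> *\<^sub>R a2 - \<beta> *\<^sub>R a1"
    define e where "e = b3 - \<alpha> * b2 - \<beta> * b1"
    have gx: "e - g \<bullet> x = (b3 - a3 \<bullet> x) - \<alpha> * (b2 - a2 \<bullet> x) - \<beta> * (b1 - a1 \<bullet> x)" for x
      by (simp add: g_def e_def inner_diff_left algebra_simps)
    have pos: "b2 - a2 \<bullet> p > 0" "b1 - a1 \<bullet> q > 0" "b1 = a1 \<bullet> p" "b2 = a2 \<bullet> q"
      "b3 - a3 \<bullet> p \<ge> 0" "b3 - a3 \<bullet> q \<ge> 0"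
    proof -
      have "a2 \<bullet> p \<le> b2" "a2 \<bullet> p \<noteq> b2" "a1 \<bullet> q \<le> b1" "a1 \<bullet> q \<noteq> b1" using p q pq s1 s2 by blast+
      then show "b2 - a2 \<bullet> p > 0" "b1 - a1 \<bullet> q > 0" by auto
      show "b1 = a1 \<bullet> p" "b2 = a2 \<bullet> q" using p q s1 s2 by blast+
      have "a3 \<bullet> p \<le> b3" "a3 \<bullet> q \<le> b3" using pq s3 by blast+
      then show "b3 - a3 \<bullet> p \<ge> 0" "b3 - a3 \<bullet> q \<ge> 0" by auto
    qed
    have nn: "\<alpha> \<ge> 0" "\<beta> \<ge> 0" using pos by (auto simp: \<alpha>_def \<beta>_def)
    have "g \<bullet> p = e" using gx[of p] pos by (simp add: \<alpha>_def)
    moreover have "g \<bullet> q = e" using gx[of q] pos by (simp add: \<beta>_def)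
    moreover have "g \<bullet> x = e" if "x \<in> E" for x
    proof -
      have "a1 \<bullet> x = b1" "a2 \<bullet> x = b2" "a3 \<bullet> x = b3"
        using that F1 F2 F3 s1 s2 s3 by blast+
      then show ?thesis using gx[of x] by simp
    qed
    ultimately have "insert q (insert p E) \<subseteq> {x. g \<bullet> x = e}" by auto
    then have "affine hull (insert q (insert p E)) \<subseteq> {x. g \<bullet> x = e}"
      by (rule hull_minimal) (rule affine_hyperplane)
    then have ge: "g \<bullet> x = e" if "x \<in> P" for x
      using that hull hull_subset[of P affine] by blast
    have slack: "b3 - a3 \<bullet> x = \<alpha> * (b2 - a2 \<bullet> x) + \<beta> * (b1 - a1 \<bullet> x)" if "x \<in> P" for x
      using gx[of x] ge[OF that] by simp
    \<comment> \<open>Two nonnegative terms with sum zero. A nonzero coefficient puts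
      \<open>F3\<close> inside \<open>F2\<close> or \<open>F1\<close>; if both are zero,
      \<open>F3\<close> is all of \<open>P\<close>.\<close>
    have zero: "\<alpha> * (b2 - a2 \<bullet> x) = 0 \<and> \<beta> * (b1 - a1 \<bullet> x) = 0" if "x \<in> F3" for x
    proof -
      have "x \<in> P" "a3 \<bullet> x = b3" using that s3 by auto
      moreover have "\<alpha> * (b2 - a2 \<bullet> x) \<ge> 0" "\<beta> * (b1 - a1 \<bullet> x) \<ge> 0"
        using nn s1 s2 \<open>x \<in> P\<close> by auto
      ultimately show ?thesis using slack[of x] by linarith
    qed
    have FP: "F3 \<subseteq> P" using s3 by blast
    show False
    proof (cases "\<alpha> = 0")
      case False
      then have "F3 \<subseteq> F2" using zero s2 FP by auto
      then show False using facet_of_antisym_subset[OF cvx F3(1) F2(1)] new by blast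
    next
      case a: True
      show False
      proof (cases "\<beta> = 0")
        case False
        then have "F3 \<subseteq> F1" using zero s1 FP by auto
        then show False using facet_of_antisym_subset[OF cvx F3(1) F1(1)] new by blast
      next
        case True
        then have "F3 = P" using a slack s3 by auto
        then show False using F3(1) by simp
      qed
    qed
  qed
  then have "?S = {F1, F2}" using F1 F2 by blast
  then show ?thesis using F2(3) by simp
qed

lemma edge_of_imp_closed_segment:
  assumes "polytope P" "e edge_of P"
  obtains a b where "e = closed_segment a b" "a \<noteq> b"
proof -
  have "polytope e" "aff_dim e = 1"
    using assms face_of_polytope_polytope unfolding edge_of_def by blast+
  moreover from this have "e \<noteq> {}" by auto
  ultimately obtain a b where "e = closed_segment a b"
    using compact_convex_collinear_segment[of e] polytope_imp_compact polytope_imp_convex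
    by (metis collinear_aff_dim order_refl)
  moreover from this have "a \<noteq> b" using \<open>aff_dim e = 1\<close> by auto
  ultimately show ?thesis by (rule that)
qed

lemma closed_segment_edge_of_neq: "closed_segment v w edge_of P \<Longrightarrow> v \<noteq> w"
  by (auto simp: edge_of_def)

text \<open>An extreme point of \<open>P\<close> lying on an edge is extreme in that segment, hence
  an endpoint. Edges at \<open>v\<close> can thus be counted by their other endpoints.\<close>

lemma card_edges_at_vertex:
  assumes P: "polytope P" and v: "v extreme_point_of P"
  shows "card {w. closed_segment v w edge_of P} = card {e. e edge_of P \<and> v \<in> e}"
proof (rule bij_betw_same_card[of "closed_segment v"])
  show "bij_betw (closed_segment v) {w. closed_segment v w edge_of P} {e. e edge_of P \<and> v \<in> e}"
  proof (rule bij_betw_imageI)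
    show "inj_on (closed_segment v) {w. closed_segment v w edge_of P}"
      by (auto simp: inj_on_def doubleton_eq_iff)
    show "closed_segment v ` {w. closed_segment v w edge_of P} = {e. e edge_of P \<and> v \<in> e}"
    proof safe
      fix e assume e: "e edge_of P" "v \<in> e"
      obtain a b where ab: "e = closed_segment a b"
        using edge_of_imp_closed_segment[OF P e(1)] by metis
      have "v extreme_point_of e"
        using e v extreme_point_of_face[of e P v] by (simp add: edge_of_def)
      then have "v = a \<or> v = b" by (simp add: ab extreme_point_of_segment)
      then show "e \<in> closed_segment v ` {w. closed_segment v w edge_of P}"
        using ab e(1) closed_segment_commute by (metis image_eqI mem_Collect_eq)
    qed
  qed
qed

text \<open>In dimension 2 the edges are the facets and a vertex is a face of codimension 2.\<close>

lemma polygon_vertex_two_edges: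
  assumes P: "polytope P" "aff_dim P = 2" and v: "v extreme_point_of P"
  shows "card {w. closed_segment v w edge_of P} = 2"
proof -
  have "{e. e edge_of P \<and> v \<in> e} = {F. F facet_of P \<and> {v} \<subseteq> F}"
    using P by (auto simp: edge_of_def facet_of_def)
  then show ?thesis
    using card_edges_at_vertex[OF P(1) v] polytope_ridge_two_facets[OF P(1), of "{v}"] P(2) v
    by (simp add: face_of_singleton)
qed

text \<open>An isometry is an orthogonal map followed by a translation, and both preserve segments,
  faces and dimension.\<close>

lemma closed_segment_edge_of_isometry_image:
  fixes f :: "'a::euclidean_space \<Rightarrow> 'a"
  assumes f: "\<And>x y. dist (f x) (f y) = dist x y" and e: "closed_segment v w edge_of F"
  shows "closed_segment (f v) (f w) edge_of f ` F"
proof -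
  define g where "g x = f x - f 0" for x
  have "orthogonal_transformation g"
    unfolding orthogonal_transformation_isometry using f by (simp add: g_def dist_norm)
  then have lin: "linear g" and inj: "inj g"
    by (auto intro: orthogonal_transformation_linear orthogonal_transformation_inj)
  have fg: "f = (+) (f 0) \<circ> g" by (auto simp: g_def)
  have im: "f ` S = (+) (f 0) ` g ` S" for S by (subst fg) (simp add: image_comp)
  have "f ` closed_segment v w = closed_segment (f v) (f w)"
    unfolding im closed_segment_linear_image[OF lin, symmetric] closed_segment_translation[symmetric]
    by (simp add: g_def)
  moreover have "f ` closed_segment v w face_of f ` F"
    using e unfolding im edge_of_def by (simp add: face_of_linear_image[OF lin inj])
  moreover have "aff_dim (f ` closed_segment v w) = 1"
    using e unfolding im edge_of_def by (simp add: aff_dim_translation_eq lin inj)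
  ultimately show ?thesis by (simp add: edge_of_def)
qed

subsection \<open>Moments of regular configurations\<close>

text \<open>Parseval's identity for an orthogonal basis that is not normalised.\<close>

lemma inner_self_orthogonal_frame:
  fixes a b c z :: "'a::euclidean_space"
  assumes dim: "DIM('a) = 3" and nz: "a \<noteq> 0" "b \<noteq> 0" "c \<noteq> 0"
    and orth: "a \<bullet> b = 0" "a \<bullet> c = 0" "b \<bullet> c = 0"
  shows "z \<bullet> z = (z \<bullet> a)\<^sup>2 / (a \<bullet> a) + (z \<bullet> b)\<^sup>2 / (b \<bullet> b) + (z \<bullet> c)\<^sup>2 / (c \<bullet> c)"
proof -
  have neq: "a \<noteq> b" "a \<noteq> c" "b \<noteq> c" using nz orth by auto
  have "pairwise orthogonal {a, b, c}"
    using orth by (auto simp: pairwise_def orthogonal_def inner_commute)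
  then have "independent {a, b, c}" using nz by (intro pairwise_orthogonal_independent) auto
  then have span: "span {a, b, c} = UNIV"
    using card_eq_dim[of "{a, b, c}" UNIV] neq dim by (auto simp: )
  \<comment> \<open>The residual of \<open>z\<close> after projection is orthogonal to a spanning
    set, hence zero.\<close>
  define y where "y = z - ((z \<bullet> a) / (a \<bullet> a)) *\<^sub>R a - ((z \<bullet> b) / (b \<bullet> b)) *\<^sub>R b - ((z \<bullet> c) / (c \<bullet> c)) *\<^sub>R c"
  have "orthogonal y x" if "x \<in> {a, b, c}" for x
    using that nz orth by (auto simp: y_def orthogonal_def inner_diff inner_commute)
  then have "orthogonal y y"
    using orthogonal_to_span[of y "{a, b, c}" y] span by auto
  then have "y = 0" by (simp add: orthogonal_self)
  then have z: "z = ((z \<bullet> a) / (a \<bullet> a)) *\<^sub>R a + ((z \<bullet> b) / (b \<bullet> b)) *\<^sub>R b + ((z \<bullet> c) / (c \<bullet> c)) *\<^sub>R c"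
    by (simp add: y_def algebra_simps)
  have "z \<bullet> z = z \<bullet> (((z \<bullet> a) / (a \<bullet> a)) *\<^sub>R a + ((z \<bullet> b) / (b \<bullet> b)) *\<^sub>R b + ((z \<bullet> c) / (c \<bullet> c)) *\<^sub>R c)"
    using z by simp
  then show ?thesis by (simp add: inner_add_right power2_eq_square)
qed

text \<open>In the plane orthogonal to \<open>u\<close>, two distinct vectors of the length of
  \<open>p\<close> at the same angle to \<open>p\<close> are mirror images in the line of
  \<open>p\<close>. Here \<open>g\<close> is the cosine of that angle, and
  \<open>z \<bullet> z - (u \<bullet> z)\<^sup>2 / (u \<bullet> u)\<close> is the squared length of
  the projection of \<open>z\<close> to the plane.\<close>

lemma equiangular_pair_in_plane:
  fixes u p x y :: "'a::euclidean_space"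
  assumes dim: "DIM('a) = 3" and u: "u \<noteq> 0" and perp: "p \<bullet> u = 0" "x \<bullet> u = 0" "y \<bullet> u = 0"
    and norms: "p \<bullet> p = R" "x \<bullet> x = R" "y \<bullet> y = R" and R: "R > 0"
    and ang: "x \<bullet> p = k" "y \<bullet> p = k" and neq: "x \<noteq> y"
  defines "g \<equiv> k / R"
  shows "g\<^sup>2 < 1" and "x + y = (2 * g) *\<^sub>R p"
    and "(x \<bullet> z)\<^sup>2 + (y \<bullet> z)\<^sup>2 =
      2 * g\<^sup>2 * (p \<bullet> z)\<^sup>2 + 2 * (1 - g\<^sup>2) * (R * (z \<bullet> z - (u \<bullet> z)\<^sup>2 / (u \<bullet> u)) - (p \<bullet> z)\<^sup>2)"
proof -
  define m n where "m = x - g *\<^sub>R p" and "n = y - g *\<^sub>R p"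
  have kg: "k = g * R" using R by (simp add: g_def)
  have mp: "p \<bullet> m = 0" "p \<bullet> n = 0" "u \<bullet> m = 0" "u \<bullet> n = 0"
    using perp ang norms kg by (auto simp: m_def n_def inner_diff_right inner_commute)
  have mm: "m \<bullet> m = R * (1 - g\<^sup>2)" "n \<bullet> n = R * (1 - g\<^sup>2)"
    using norms ang kg by (auto simp: m_def n_def inner_diff inner_commute algebra_simps power2_eq_square)
  have "m \<noteq> n" using neq by (auto simp: m_def n_def)
  then have "R * (1 - g\<^sup>2) \<noteq> 0" using mm by (metis inner_eq_zero_iff)
  moreover have "R * (1 - g\<^sup>2) \<ge> 0" using mm by (metis inner_ge_zero)
  ultimately have pos: "R * (1 - g\<^sup>2) > 0" by linarith
  then show g1: "g\<^sup>2 < 1" using R by (simp add: zero_less_mult_iff)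
  have nz: "p \<noteq> 0" "m \<noteq> 0" using norms(1) R mm pos by auto
  note frame = inner_self_orthogonal_frame[OF dim u nz, unfolded inner_commute[of u p] perp mp mm norms, OF refl refl refl]
  \<comment> \<open>Both \<open>m\<close> and \<open>n\<close> are orthogonal to \<open>u\<close>
    and \<open>p\<close>, so Parseval in the frame \<open>u\<close>, \<open>p\<close>,
    \<open>m\<close> is the equality case of Cauchy-Schwarz. With equal lengths, \<open>n\<close> is
    \<open>m\<close> or \<open>- m\<close>.\<close>
  have "(n \<bullet> m)\<^sup>2 = (R * (1 - g\<^sup>2))\<^sup>2"
  proof -
    have "R * (1 - g\<^sup>2) = (n \<bullet> m)\<^sup>2 / (R * (1 - g\<^sup>2))"
      using frame[of n] mp mm(2) by (simp add: inner_commute)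
    then show ?thesis using pos by (simp only: power2_eq_square nonzero_eq_divide_eq)
  qed
  then consider "n \<bullet> m = R * (1 - g\<^sup>2)" | "n \<bullet> m = - (R * (1 - g\<^sup>2))"
    using power2_eq_iff by blast
  then have "n = - m"
  proof cases
    case 1
    then have "(n - m) \<bullet> (n - m) = 0" using mm by (simp add: inner_diff inner_commute)
    then show ?thesis using \<open>m \<noteq> n\<close> by simp
  next
    case 2
    then have "(n + m) \<bullet> (n + m) = 0" using mm by (simp add: inner_add inner_commute)
    then show ?thesis by (simp add: eq_neg_iff_add_eq_0)
  qed
  then have xy: "x = g *\<^sub>R p + m" "y = g *\<^sub>R p - m" by (auto simp: m_def n_def algebra_simps)
  show "x + y = (2 * g) *\<^sub>R p" by (simp add: xy scaleR_2[symmetric])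
  have "R * (1 - g\<^sup>2) * (z \<bullet> z - (u \<bullet> z)\<^sup>2 / (u \<bullet> u)) = (1 - g\<^sup>2) * (p \<bullet> z)\<^sup>2 + (m \<bullet> z)\<^sup>2"
  proof -
    have "z \<bullet> z - (u \<bullet> z)\<^sup>2 / (u \<bullet> u) = (p \<bullet> z)\<^sup>2 / R + (m \<bullet> z)\<^sup>2 / (R * (1 - g\<^sup>2))"
      using frame[of z] by (simp add: inner_commute)
    then show ?thesis using pos R g1 by (auto simp: distrib_left)
  qed
  then have "(m \<bullet> z)\<^sup>2 = (1 - g\<^sup>2) * (R * (z \<bullet> z - (u \<bullet> z)\<^sup>2 / (u \<bullet> u)) - (p \<bullet> z)\<^sup>2)"
    by (simp add: algebra_simps)
  moreover have "(x \<bullet> z)\<^sup>2 + (y \<bullet> z)\<^sup>2 = 2 * g\<^sup>2 * (p \<bullet> z)\<^sup>2 + 2 * (m \<bullet> z)\<^sup>2"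
    by (simp add: xy inner_add_left inner_diff_left power2_eq_square algebra_simps)
  ultimately show "(x \<bullet> z)\<^sup>2 + (y \<bullet> z)\<^sup>2 =
      2 * g\<^sup>2 * (p \<bullet> z)\<^sup>2 + 2 * (1 - g\<^sup>2) * (R * (z \<bullet> z - (u \<bullet> z)\<^sup>2 / (u \<bullet> u)) - (p \<bullet> z)\<^sup>2)"
    by simp
qed

text \<open>Double counting: by symmetry of \<open>E\<close>, each \<open>w\<close> is summed once
  for each of its \<open>q\<close> neighbours. It serves twice below, for the pairs around a vertex
  (\<open>q = 2\<close>) and for the whole vertex set.\<close>

lemma sum_over_neighbours:
  fixes f :: "'i \<Rightarrow> 'a::real_vector"
  assumes "finite V" "\<And>v w. E v w \<Longrightarrow> E w v" "\<And>v. v \<in> V \<Longrightarrow> card {w\<in>V. E v w} = q"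
  shows "(\<Sum>v\<in>V. \<Sum>w\<in>{w\<in>V. E v w}. f w) = real q *\<^sub>R sum f V"
proof -
  have "(\<Sum>v\<in>V. \<Sum>w\<in>{w\<in>V. E v w}. f w) = (\<Sum>w\<in>V. \<Sum>v\<in>{v\<in>V. E v w}. f w)"
    by (rule sum.swap_restrict) (use assms in auto)
  also have "\<dots> = (\<Sum>w\<in>V. real q *\<^sub>R f w)"
  proof (rule sum.cong[OF refl])
    fix w assume "w \<in> V"
    moreover have "{v\<in>V. E v w} = {v\<in>V. E w v}" using assms(2) by blast
    ultimately show "(\<Sum>v\<in>{v\<in>V. E v w}. f w) = real q *\<^sub>R f w"
      using assms(3) by (simp add: sum_constant_scaleR)
  qed
  finally show ?thesis by (simp add: scaleR_sum_right)
qed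

text \<open>The vectors \<open>u w\<close> end on a circle with axis \<open>o'\<close>.
  \<open>R\<close> links each of them to two others at a fixed angle, and summing the pair
  identities over the circle gives linear equations for both moments.\<close>

lemma regular_cone_moments:
  fixes u :: "'i \<Rightarrow> 'a::euclidean_space" and o' z :: 'a and t l k :: real
  assumes dim: "DIM('a) = 3" and fin: "finite N" and ne: "N \<noteq> {}"
    and t: "\<And>w. w \<in> N \<Longrightarrow> u w \<bullet> u w = t" "o' \<bullet> o' = t"
    and l: "\<And>w. w \<in> N \<Longrightarrow> o' \<bullet> u w = l"
    and inj: "inj_on u N"
    and sym: "\<And>w x. R w x \<Longrightarrow> R x w"
    and two: "\<And>w. w \<in> N \<Longrightarrow> card {x\<in>N. R w x} = 2"
    and k: "\<And>w x. w \<in> N \<Longrightarrow> x \<in> N \<Longrightarrow> R w x \<Longrightarrow> u w \<bullet> u x = k"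
  shows "l\<^sup>2 < t\<^sup>2" and "(\<Sum>w\<in>N. u w) = (card N * l / t) *\<^sub>R o'"
    and "(\<Sum>w\<in>N. (u w \<bullet> z)\<^sup>2) =
      card N * ((l / t)\<^sup>2 * (o' \<bullet> z)\<^sup>2 + (1 - (l / t)\<^sup>2) / 2 * (t * (z \<bullet> z) - (o' \<bullet> z)\<^sup>2))"
proof -
  \<comment> \<open>The projection of \<open>u w\<close> to the plane orthogonal to the axis;
    \<open>r\<close> is the squared radius of the circle.\<close>
  define p where "p w = u w - (l / t) *\<^sub>R o'" for w
  define r where "r = t - l\<^sup>2 / t"
  obtain w0 where w0: "w0 \<in> N" using ne by blast
  obtain x0 y0 where xy0: "{x\<in>N. R w0 x} = {x0, y0}" "x0 \<noteq> y0"
    using two[OF w0] by (auto simp: card_2_iff)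
  have N0: "x0 \<in> N" "y0 \<in> N" using xy0(1) by blast+
  then have u0: "u x0 \<noteq> u y0" using inj xy0(2) by (auto simp: inj_on_def)
  have tpos: "t > 0"
  proof -
    have "t \<ge> 0" using t(1)[OF N0(1)] inner_ge_zero[of "u x0"] by simp
    moreover have "t \<noteq> 0" using t(1)[OF N0(1)] t(1)[OF N0(2)] u0 by auto
    ultimately show ?thesis by simp
  qed
  then have o0: "o' \<noteq> 0" using t(2) by auto
  have po: "p w \<bullet> o' = 0" if "w \<in> N" for w
    using that l tpos t(2) by (simp add: p_def inner_diff inner_commute)
  have pp: "p w \<bullet> p x = u w \<bullet> u x - l\<^sup>2 / t" if "w \<in> N" "x \<in> N" for w x
    using that l tpos t(2)
    by (simp add: p_def inner_diff inner_commute power2_eq_square)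
  have prr: "p w \<bullet> p w = r" if "w \<in> N" for w using pp[OF that that] t(1)[OF that] by (simp add: r_def)
  \<comment> \<open>Two distinct points on the circle force a positive radius, which is the strict
    inequality between \<open>l\<^sup>2\<close> and \<open>t\<^sup>2\<close>.\<close>
  have "p x0 \<noteq> p y0" using u0 by (simp add: p_def)
  then have "r \<noteq> 0" using prr[OF N0(1)] prr[OF N0(2)] by auto
  moreover have "r \<ge> 0" using prr[OF w0] inner_ge_zero[of "p w0"] by simp
  ultimately have rpos: "r > 0" by simp
  then show "l\<^sup>2 < t\<^sup>2" using tpos by (simp add: r_def field_simps power2_eq_square)
  define g where "g = (k - l\<^sup>2 / t) / r"
  define h where "h = r * (z \<bullet> z - (o' \<bullet> z)\<^sup>2 / t)"
  have step: "g\<^sup>2 < 1 \<and> (\<Sum>x\<in>{x\<in>N. R w x}. p x) = (2 * g) *\<^sub>R p w \<and>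
     (\<Sum>x\<in>{x\<in>N. R w x}. (p x \<bullet> z)\<^sup>2) = 2 * g\<^sup>2 * (p w \<bullet> z)\<^sup>2 + 2 * (1 - g\<^sup>2) * (h - (p w \<bullet> z)\<^sup>2)"
    if w: "w \<in> N" for w
  proof -
    obtain x y where xy: "{x\<in>N. R w x} = {x, y}" "x \<noteq> y"
      using two[OF w] by (auto simp: card_2_iff)
    have N: "x \<in> N" "y \<in> N" "R w x" "R w y" using xy(1) by blast+
    then have "p x \<noteq> p y" using inj xy(2) by (auto simp: inj_on_def p_def)
    have ang: "p x \<bullet> p w = k - l\<^sup>2 / t" "p y \<bullet> p w = k - l\<^sup>2 / t"
      using pp k N w by (simp_all add: inner_commute)
    note pair = equiangular_pair_in_plane[OF dim o0 po[OF w] po[OF N(1)] po[OF N(2)]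
        prr[OF w] prr[OF N(1)] prr[OF N(2)] rpos ang \<open>p x \<noteq> p y\<close>]
    show ?thesis using pair(1,2) pair(3)[of z] xy by (simp add: g_def h_def t(2))
  qed
  have g1: "g\<^sup>2 < 1" using step[OF w0] by blast
  then have "g \<noteq> 1" by auto
  \<comment> \<open>Summing the pair identity over \<open>N\<close> counts every \<open>p x\<close>
    twice; since \<open>g \<noteq> 1\<close>, the total must vanish.\<close>
  have "real 2 *\<^sub>R sum p N = (\<Sum>w\<in>N. (2 * g) *\<^sub>R p w)"
    using sum_over_neighbours[of N R 2 p, OF fin sym two] step by simp
  then have "2 *\<^sub>R sum p N = (2 * g) *\<^sub>R sum p N" by (simp add: scaleR_sum_right)
  then have "sum p N = 0" using \<open>g \<noteq> 1\<close> by simp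
  then have p0: "(\<Sum>w\<in>N. u w) = (\<Sum>w\<in>N. (l / t) *\<^sub>R o')"
    by (simp add: p_def sum_subtractf)
  then show "(\<Sum>w\<in>N. u w) = (card N * l / t) *\<^sub>R o'" by (simp add: sum_constant_scaleR)
  define Q where "Q = (\<Sum>w\<in>N. (p w \<bullet> z)\<^sup>2)"
  \<comment> \<open>The same averaging for squares gives a linear equation for \<open>Q\<close>,
    solvable because \<open>g\<^sup>2 < 1\<close>. The resulting factor 1/2 is isotropy in a
    plane.\<close>
  have "2 * Q = (\<Sum>w\<in>N. 2 * g\<^sup>2 * (p w \<bullet> z)\<^sup>2 + 2 * (1 - g\<^sup>2) * (h - (p w \<bullet> z)\<^sup>2))"
    using sum_over_neighbours[of N R 2 "\<lambda>w. (p w \<bullet> z)\<^sup>2", OF fin sym two] step by (simp add: Q_def)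
  also have "\<dots> = 2 * g\<^sup>2 * Q + 2 * (1 - g\<^sup>2) * (card N * h - Q)"
    by (simp add: Q_def sum.distrib sum_distrib_left[symmetric] sum_subtractf)
  finally have "(1 - g\<^sup>2) * (2 * Q) = (1 - g\<^sup>2) * (card N * h)" by (simp add: algebra_simps)
  then have Q: "Q = card N * h / 2" using g1 by simp
  \<comment> \<open>Splitting \<open>u w\<close> into axial and planar parts; the cross term dies
    because the planar parts sum to zero.\<close>
  have "(\<Sum>w\<in>N. (u w \<bullet> z)\<^sup>2) = (\<Sum>w\<in>N. (p w \<bullet> z)\<^sup>2 + (2 * (l / t) * (o' \<bullet> z)) * (p w \<bullet> z) + (l / t)\<^sup>2 * (o' \<bullet> z)\<^sup>2)"
    by (rule sum.cong[OF refl]) (simp add: p_def inner_diff_left power2_eq_square algebra_simps)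
  also have "\<dots> = Q + (2 * (l / t) * (o' \<bullet> z)) * (sum p N \<bullet> z) + card N * ((l / t)\<^sup>2 * (o' \<bullet> z)\<^sup>2)"
    by (simp only: Q_def sum.distrib sum_distrib_left[symmetric] inner_sum_left sum_constant) simp
  also have "\<dots> = card N * (h / 2 + (l / t)\<^sup>2 * (o' \<bullet> z)\<^sup>2)"
    by (simp add: \<open>sum p N = 0\<close> Q algebra_simps)
  also have "h = (1 - (l / t)\<^sup>2) * (t * (z \<bullet> z) - (o' \<bullet> z)\<^sup>2)"
    using tpos by (simp add: h_def r_def field_simps power2_eq_square)
  finally show "(\<Sum>w\<in>N. (u w \<bullet> z)\<^sup>2) =
      card N * ((l / t)\<^sup>2 * (o' \<bullet> z)\<^sup>2 + (1 - (l / t)\<^sup>2) / 2 * (t * (z \<bullet> z) - (o' \<bullet> z)\<^sup>2))"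
    by (simp add: algebra_simps)
qed

text \<open>The averaging is repeated one level up: the cone identities at each vertex, summed over
  all vertices, are linear equations for the global moments.\<close>

lemma regular_configuration_moments:
  fixes u :: "'i \<Rightarrow> 'a::euclidean_space" and z :: 'a and t l k :: real
  assumes dim: "DIM('a) = 3" and fin: "finite V" and inj: "inj_on u V"
    and t: "\<And>v. v \<in> V \<Longrightarrow> u v \<bullet> u v = t"
    and symE: "\<And>v w. E v w \<Longrightarrow> E w v"
    and q: "\<And>v. v \<in> V \<Longrightarrow> card {w\<in>V. E v w} = q" and qpos: "q > 0"
    and l: "\<And>v w. v \<in> V \<Longrightarrow> w \<in> V \<Longrightarrow> E v w \<Longrightarrow> u v \<bullet> u w = l"
    and sym: "\<And>v w x. R v w x \<Longrightarrow> R v x w"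
    and two: "\<And>v w. v \<in> V \<Longrightarrow> w \<in> V \<Longrightarrow> E v w \<Longrightarrow> card {x\<in>V. E v x \<and> R v w x} = 2"
    and k: "\<And>v w x. v \<in> V \<Longrightarrow> w \<in> V \<Longrightarrow> x \<in> V \<Longrightarrow> R v w x \<Longrightarrow> u w \<bullet> u x = k"
  shows "sum u V = 0" and "(\<Sum>v\<in>V. (u v \<bullet> z)\<^sup>2) = card V * t * (z \<bullet> z) / 3"
proof -
  define N where "N v = {w\<in>V. E v w}" for v
  have cone: "l\<^sup>2 < t\<^sup>2 \<and> (\<Sum>w\<in>N v. u w) = (q * l / t) *\<^sub>R u v \<and>
    (\<Sum>w\<in>N v. (u w \<bullet> z)\<^sup>2) =
      q * ((l / t)\<^sup>2 * (u v \<bullet> z)\<^sup>2 + (1 - (l / t)\<^sup>2) / 2 * (t * (z \<bullet> z) - (u v \<bullet> z)\<^sup>2))"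
    if v: "v \<in> V" for v
  proof -
    have c: "card (N v) = q" using q v by (simp add: N_def)
    have N: "w \<in> V" "E v w" if "w \<in> N v" for w using that by (auto simp: N_def)
    have "finite (N v)" using fin by (simp add: N_def)
    moreover have "N v \<noteq> {}" using c qpos by auto
    moreover have "u w \<bullet> u w = t" if "w \<in> N v" for w by (rule t[OF N(1)[OF that]])
    moreover note t[OF v]
    moreover have "u v \<bullet> u w = l" if "w \<in> N v" for w by (rule l[OF v N[OF that]])
    moreover have "inj_on u (N v)" using inj by (rule inj_on_subset) (auto simp: N_def)
    moreover note sym[of v]
    moreover have "card {x \<in> N v. R v w x} = 2" if "w \<in> N v" for w
      using two[OF v N[OF that]] by (simp add: N_def conj_assoc)
    moreover have "u w \<bullet> u x = k" if "w \<in> N v" "x \<in> N v" "R v w x" for w x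
      by (rule k[OF v N(1)[OF that(1)] N(1)[OF that(2)] that(3)])
    ultimately have "l\<^sup>2 < t\<^sup>2 \<and> (\<Sum>w\<in>N v. u w) = (card (N v) * l / t) *\<^sub>R u v \<and>
      (\<Sum>w\<in>N v. (u w \<bullet> z)\<^sup>2) =
        card (N v) * ((l / t)\<^sup>2 * (u v \<bullet> z)\<^sup>2 + (1 - (l / t)\<^sup>2) / 2 * (t * (z \<bullet> z) - (u v \<bullet> z)\<^sup>2))"
      by (intro conjI regular_cone_moments[OF dim, of "N v" u t "u v" l "R v" k])
    then show ?thesis by (simp only: c)
  qed
  have "sum u V = 0 \<and> (\<Sum>v\<in>V. (u v \<bullet> z)\<^sup>2) = card V * t * (z \<bullet> z) / 3"
  proof (cases "V = {}")
    case False
    then have lt: "l\<^sup>2 < t\<^sup>2" using cone by blast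
    then have tn: "t \<noteq> 0" by auto
    \<comment> \<open>The total is fixed under multiplication by \<open>l / t\<close>, which is not
      1.\<close>
    have "real q *\<^sub>R sum u V = (\<Sum>v\<in>V. (q * l / t) *\<^sub>R u v)"
      using sum_over_neighbours[of V E q u, OF fin symE q] cone by (simp add: N_def)
    then have "real q *\<^sub>R sum u V = (q * l / t) *\<^sub>R sum u V" by (simp add: scaleR_sum_right)
    moreover have "q * l / t \<noteq> q" using lt tn qpos by (auto simp: divide_simps)
    ultimately have s: "sum u V = 0" by auto
    define T where "T = (\<Sum>v\<in>V. (u v \<bullet> z)\<^sup>2)"
    define m where "m = (l / t)\<^sup>2"
    have m: "m < 1" using lt tn by (simp add: m_def power_divide)
    have "q * T = (\<Sum>v\<in>V. q * (m * (u v \<bullet> z)\<^sup>2 + (1 - m) / 2 * (t * (z \<bullet> z) - (u v \<bullet> z)\<^sup>2)))"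
      using sum_over_neighbours[of V E q "\<lambda>v. (u v \<bullet> z)\<^sup>2", OF fin symE q] cone by (simp add: N_def T_def m_def)
    also have "\<dots> = q * (m * T + (1 - m) / 2 * (card V * (t * (z \<bullet> z)) - T))"
      by (simp only: T_def sum.distrib sum_distrib_left[symmetric] sum_subtractf sum_constant) simp
    \<comment> \<open>Dividing by \<open>1 - m\<close>, which is positive, leaves twice
      \<open>T\<close> equal to \<open>card V * (t * (z \<bullet> z)) - T\<close>: the origin of the
      3.\<close>
    finally have "T = m * T + (1 - m) / 2 * (card V * (t * (z \<bullet> z)) - T)" using qpos by simp
    then have "(1 - m) * (3 * T) = (1 - m) * (card V * t * (z \<bullet> z))" by (simp add: field_simps)
    then have "3 * T = card V * t * (z \<bullet> z)" using m by simp
    then show ?thesis using s by (simp add: T_def)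
  qed auto
  then show "sum u V = 0" and "(\<Sum>v\<in>V. (u v \<bullet> z)\<^sup>2) = card V * t * (z \<bullet> z) / 3" by auto
qed

subsection \<open>Platonic solids\<close>

text \<open>Equal angles are traded for equal inner products, the form used by the moment
  computation. Cauchy-Schwarz keeps the quotient in the range where \<open>cos\<close> inverts
  \<open>arccos\<close>.\<close>

lemma regular_polygon_edge_length_and_angle:
  assumes "regular_polygon F"
  obtains s k where "\<And>v a. closed_segment v a edge_of F \<Longrightarrow> dist v a = s"
    and "\<And>v a b. closed_segment v a edge_of F \<Longrightarrow> closed_segment v b edge_of F \<Longrightarrow> a \<noteq> b \<Longrightarrow>
      (a - v) \<bullet> (b - v) = k"
proof -
  obtain s \<theta> where s: "\<And>v a. closed_segment v a edge_of F \<Longrightarrow> dist v a = s"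
    and \<theta>: "\<And>v a b. closed_segment v a edge_of F \<Longrightarrow> closed_segment v b edge_of F \<Longrightarrow> a \<noteq> b \<Longrightarrow> angle_at v a b = \<theta>"
    using assms unfolding regular_polygon_def by metis
  have "(a - v) \<bullet> (b - v) = s * s * cos \<theta>"
    if e: "closed_segment v a edge_of F" "closed_segment v b edge_of F" "a \<noteq> b" for v a b
  proof -
    have n: "norm (a - v) = s" "norm (b - v) = s"
      using s[OF e(1)] s[OF e(2)] by (simp_all add: dist_norm norm_minus_commute)
    have "s > 0" using n closed_segment_edge_of_neq[OF e(1)] by auto
    have "\<bar>(a - v) \<bullet> (b - v)\<bar> \<le> s * s" using Cauchy_Schwarz_ineq2[of "a - v" "b - v"] n by simp
    then have "\<bar>(a - v) \<bullet> (b - v) / (s * s)\<bar> \<le> 1" using \<open>s > 0\<close> by (simp add: abs_mult)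
    then have "cos \<theta> = (a - v) \<bullet> (b - v) / (s * s)"
      using \<theta>[OF e] n by (auto simp: angle_at_def abs_le_iff cos_arccos_abs)
    then show ?thesis using \<open>s > 0\<close> by simp
  qed
  with s show ?thesis by (rule that)
qed

lemma regular_polygon_has_corner:
  assumes "regular_polygon F"
  obtains v a b where "closed_segment v a edge_of F" "closed_segment v b edge_of F" "a \<noteq> b"
proof -
  have F: "polytope F" "aff_dim F = 2" using assms by (auto simp: regular_polygon_def)
  then have "F \<noteq> {}" by auto
  then obtain v where v: "v extreme_point_of F"
    using extreme_point_exists_convex F polytope_imp_compact polytope_imp_convex by metis
  obtain a b where "{w. closed_segment v w edge_of F} = {a, b}" "a \<noteq> b"
    using polygon_vertex_two_edges[OF F v] by (auto simp: card_2_iff)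
  then show ?thesis using that by blast
qed

text \<open>Regularity alone gives constants for each facet. Congruence carries one fixed corner of
  \<open>F0\<close> to a corner of any other facet, so the constants agree.\<close>

lemma platonic_solid_edge_length_and_angle:
  assumes "platonic_solid P"
  obtains s k where "\<And>F v a. F facet_of P \<Longrightarrow> closed_segment v a edge_of F \<Longrightarrow> dist v a = s"
    and "\<And>F v a b. F facet_of P \<Longrightarrow> closed_segment v a edge_of F \<Longrightarrow> closed_segment v b edge_of F \<Longrightarrow>
      a \<noteq> b \<Longrightarrow> (a - v) \<bullet> (b - v) = k"
proof -
  have P: "polytope P" "aff_dim P = 3" and reg: "\<And>F. F facet_of P \<Longrightarrow> regular_polygon F"
    and cong: "\<And>F G. F facet_of P \<Longrightarrow> G facet_of P \<Longrightarrow> congruent_sets F G"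
    using assms by (auto simp: platonic_solid_def)
  obtain F0 where F0: "F0 facet_of P" using polytope_facet_exists[of P] P by auto
  obtain v0 a0 b0 where c0: "closed_segment v0 a0 edge_of F0" "closed_segment v0 b0 edge_of F0" "a0 \<noteq> b0"
    using regular_polygon_has_corner[OF reg[OF F0]] by metis
  have "dist v a = dist v0 a0 \<and> (\<forall>b. closed_segment v b edge_of G \<longrightarrow> a \<noteq> b \<longrightarrow>
       (a - v) \<bullet> (b - v) = (a0 - v0) \<bullet> (b0 - v0))"
    if G: "G facet_of P" and e: "closed_segment v a edge_of G" for G v a
  proof -
    obtain f where f: "\<And>x y. dist (f x) (f y) = dist x y" "f ` F0 = G"
      using cong[OF F0 G] unfolding congruent_sets_def by blast
    have im: "closed_segment (f v0) (f a0) edge_of G" "closed_segment (f v0) (f b0) edge_of G"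
      using closed_segment_edge_of_isometry_image[of f, OF f(1)] c0 f(2) by metis+
    have fab: "f a0 \<noteq> f b0" using f(1)[of a0 b0] c0(3) by auto
    \<comment> \<open>Polarisation writes the inner product through distances, which
      \<open>f\<close> preserves.\<close>
    have polar: "(x - z) \<bullet> (y - z) = ((dist x z)\<^sup>2 + (dist y z)\<^sup>2 - (dist x y)\<^sup>2) / 2" for x y z :: "real^3"
      by (simp add: dist_norm power2_norm_eq_inner inner_diff inner_commute field_simps)
    have corner: "(f a0 - f v0) \<bullet> (f b0 - f v0) = (a0 - v0) \<bullet> (b0 - v0)"
      by (simp add: polar f(1))
    obtain s k where s: "\<And>v a. closed_segment v a edge_of G \<Longrightarrow> dist v a = s"
      and k: "\<And>v a b. closed_segment v a edge_of G \<Longrightarrow> closed_segment v b edge_of G \<Longrightarrow> a \<noteq> b \<Longrightarrow>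
        (a - v) \<bullet> (b - v) = k"
      using regular_polygon_edge_length_and_angle[OF reg[OF G]] by blast
    show ?thesis using s[OF e] s[OF im(1)] f(1) k[OF e] k[OF im fab] corner by simp
  qed
  then show ?thesis by (intro that) blast+
qed

section \<open>Incidence of edges and facets in dimension three\<close>

lemma edge_in_two_facets:
  assumes P: "polytope P" "aff_dim P = 3" and e: "e edge_of P"
  shows "card {F. F facet_of P \<and> e edge_of F} = 2"
proof -
  have "e edge_of F \<longleftrightarrow> e \<subseteq> F" if "F facet_of P" for F
    using face_of_face[OF facet_of_imp_face_of[OF that], of e] e by (simp add: edge_of_def)
  then have "{F. F facet_of P \<and> e edge_of F} = {F. F facet_of P \<and> e \<subseteq> F}" by auto
  moreover have "e \<noteq> {}" using e by (auto simp: edge_of_def)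
  ultimately show ?thesis
    using polytope_ridge_two_facets[OF P(1), of e] e P(2) by (simp add: edge_of_def)
qed

lemma edge_of_facet_edge_of:
  "F facet_of P \<Longrightarrow> e edge_of F \<Longrightarrow> e edge_of P"
  by (auto simp: edge_of_def facet_of_def intro: face_of_trans)

lemma extreme_point_of_facet_two_edges:
  assumes P: "polytope P" "aff_dim P = 3" and F: "F facet_of P"
    and v: "v extreme_point_of P" "v \<in> F"
  shows "card {w. closed_segment v w edge_of F} = 2"
proof (rule polygon_vertex_two_edges)
  show "polytope F" "aff_dim F = 2" "v extreme_point_of F"
    using face_of_polytope_polytope[OF P(1)] extreme_point_of_face[of F P v] F P(2) v
    by (auto simp: facet_of_def)
qed

text \<open>Double counting of incident pairs of an edge and a facet at \<open>v\<close>: each edge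
  lies in two facets and each facet has two edges at \<open>v\<close>. This turns the constant
  number of facets at a vertex into a constant number of neighbours.\<close>

lemma card_edges_eq_card_facets_at_vertex:
  assumes P: "polytope P" "aff_dim P = 3" and v: "v extreme_point_of P"
  shows "card {w. closed_segment v w edge_of P} = card {F. F facet_of P \<and> v \<in> F}"
proof -
  let ?N = "{w. closed_segment v w edge_of P}" and ?F = "{F. F facet_of P \<and> v \<in> F}"
  have finF: "finite ?F"
    using finite_polyhedron_facets[OF polytope_imp_polyhedron[OF P(1)]] by (rule rev_finite_subset) auto
  have finN: "finite ?N"
    by (rule finite_subset[OF _ finite_polyhedron_extreme_points[OF polytope_imp_polyhedron[OF P(1)]]])
      (auto simp: edge_of_def dest: segment_face_of)
  have v_in: "v \<in> F" if "closed_segment v w edge_of F" for F w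
    using edge_of_imp_subset[OF that] by auto
  have "2 * card ?N = (\<Sum>w\<in>?N. card {F\<in>?F. closed_segment v w edge_of F})"
  proof -
    have "{F\<in>?F. closed_segment v w edge_of F} = {F. F facet_of P \<and> closed_segment v w edge_of F}" for w
      using v_in by blast
    then show ?thesis using edge_in_two_facets[OF P] by simp
  qed
  also have "\<dots> = (\<Sum>w\<in>?N. \<Sum>F\<in>{F\<in>?F. closed_segment v w edge_of F}. 1)"
    by simp
  also have "\<dots> = (\<Sum>F\<in>?F. \<Sum>w\<in>{w\<in>?N. closed_segment v w edge_of F}. 1)"
    by (rule sum.swap_restrict[OF finN finF])
  also have "\<dots> = (\<Sum>F\<in>?F. 2)"
  proof (rule sum.cong[OF refl])
    fix F assume F: "F \<in> ?F"
    then have "{w\<in>?N. closed_segment v w edge_of F} = {w. closed_segment v w edge_of F}"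
      using edge_of_facet_edge_of by blast
    then show "(\<Sum>w\<in>{w\<in>?N. closed_segment v w edge_of F}. 1) = (2::nat)"
      using extreme_point_of_facet_two_edges[OF P _ v] F by simp
  qed
  finally show ?thesis by simp
qed

text \<open>Each of the two facets through the edge has exactly one further edge at
  \<open>v\<close>; the point is that these two edges differ.\<close>

lemma two_face_neighbours:
  assumes P: "polytope P" "aff_dim P = 3" and e: "closed_segment v w edge_of P"
  shows "card {x. x \<noteq> w \<and> (\<exists>F. F facet_of P \<and> closed_segment v w edge_of F \<and> closed_segment v x edge_of F)} = 2"
    (is "card ?X = 2")
proof -
  have v: "v extreme_point_of P" using e segment_face_of by (auto simp: edge_of_def)
  obtain F G where FG: "{F. F facet_of P \<and> closed_segment v w edge_of F} = {F, G}" "F \<noteq> G"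
    using edge_in_two_facets[OF P e] by (auto simp: card_2_iff)
  have other: "\<exists>x. x \<noteq> w \<and> {y. closed_segment v y edge_of H} = {w, x}"
    if H: "H facet_of P" "closed_segment v w edge_of H" for H
  proof -
    have "v \<in> H" using edge_of_imp_subset[OF H(2)] by auto
    obtain a b where ab: "{y. closed_segment v y edge_of H} = {a, b}" "a \<noteq> b"
      using extreme_point_of_facet_two_edges[OF P H(1) v \<open>v \<in> H\<close>] by (auto simp: card_2_iff)
    have "w = a \<or> w = b" using ab(1) H(2) by blast
    then show ?thesis using ab by auto
  qed
  have F: "F facet_of P" "closed_segment v w edge_of F" and G: "G facet_of P" "closed_segment v w edge_of G"
    using FG(1) by blast+
  obtain x where x: "x \<noteq> w" "{y. closed_segment v y edge_of F} = {w, x}" using other[OF F] by blast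
  obtain y where y: "y \<noteq> w" "{x. closed_segment v x edge_of G} = {w, y}" using other[OF G] by blast
  have "?X = {x, y}"
  proof -
    have "?X = {z. z \<noteq> w \<and> (\<exists>H\<in>{F, G}. closed_segment v z edge_of H)}"
      unfolding FG(1)[symmetric] by blast
    also have "\<dots> = {x, y}" using x y by blast
    finally show ?thesis .
  qed
  moreover have "x \<noteq> y"
  proof
    assume "x = y"
    have cvxP: "convex P" using P polytope_imp_convex by blast
    have cvx: "convex F" using F(1) facet_of_imp_face_of face_of_imp_convex by blast
    have FG_face: "F \<inter> G face_of F"
      using F(1) G(1) facet_of_imp_face_of facet_of_imp_subset[OF F(1)]
      by (meson face_of_Int face_of_subset inf_le1)
    have "F \<inter> G \<noteq> F" using facet_of_antisym_subset[OF cvxP F(1) G(1)] FG(2) by blast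
    then have lt: "aff_dim (F \<inter> G) < 2"
      using face_of_aff_dim_lt[OF cvx FG_face] F(1) P(2) by (simp add: facet_of_def)
    \<comment> \<open>\<open>F \<inter> G\<close> is a face of dimension at most 1, so a common edge
      fills it. Two facets cannot share two distinct edges.\<close>
    have seg: "closed_segment v z = F \<inter> G" if "closed_segment v z edge_of F" "closed_segment v z edge_of G" for z
    proof (rule ccontr)
      assume "closed_segment v z \<noteq> F \<inter> G"
      moreover have "closed_segment v z face_of F \<inter> G"
        using that by (auto simp: edge_of_def intro: face_of_subset[of _ F] dest: face_of_imp_subset)
      ultimately have "aff_dim (closed_segment v z) < aff_dim (F \<inter> G)"
        using face_of_aff_dim_lt face_of_imp_convex[OF FG_face] by blast
      then show False using lt that by (simp add: edge_of_def)
    qed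
    have "closed_segment v x edge_of F" "closed_segment v x edge_of G"
      using x(2) y(2) \<open>x = y\<close> by blast+
    then have "closed_segment v x = closed_segment v w" using seg F(2) G(2) by blast
    then show False using x(1) by (auto simp: doubleton_eq_iff)
  qed
  ultimately show ?thesis by simp
qed

theorem platonic_solid_vertex_moments:
  fixes P :: "(real^3) set" and r :: real
  assumes plat: "platonic_solid P" and circ: "circumscribed_sphere P c r"
  defines "V \<equiv> {v. v extreme_point_of P}"
  shows "(\<Sum>v\<in>V. v - c) = 0" and "(\<Sum>v\<in>V. ((v - c) \<bullet> z)\<^sup>2) = card V * r\<^sup>2 * (z \<bullet> z) / 3"
proof -
  have P: "polytope P" "aff_dim P = 3" using plat by (auto simp: platonic_solid_def)
  note ph = polytope_imp_polyhedron[OF P(1)]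
  obtain q where q: "\<And>v. v extreme_point_of P \<Longrightarrow> card {F. F facet_of P \<and> v \<in> F} = q"
    using plat by (auto simp: platonic_solid_def)
  obtain s k where s: "\<And>F v a. F facet_of P \<Longrightarrow> closed_segment v a edge_of F \<Longrightarrow> dist v a = s"
    and k: "\<And>F v a b. F facet_of P \<Longrightarrow> closed_segment v a edge_of F \<Longrightarrow> closed_segment v b edge_of F \<Longrightarrow>
      a \<noteq> b \<Longrightarrow> (a - v) \<bullet> (b - v) = k"
    using platonic_solid_edge_length_and_angle[OF plat] by blast
  \<comment> \<open>\<open>E\<close> is adjacency of vertices; \<open>R v\<close> relates two
    neighbours of \<open>v\<close> whose edges to \<open>v\<close> lie in a common facet.\<close>
  define E where "E v w \<longleftrightarrow> closed_segment v w edge_of P" for v w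
  define R where "R v w x \<longleftrightarrow> x \<noteq> w \<and> (\<exists>F. F facet_of P \<and> closed_segment v w edge_of F \<and> closed_segment v x edge_of F)"
    for v w x
  have EV: "w \<in> V" if "E v w" for v w
    using that segment_face_of by (auto simp: E_def V_def edge_of_def)
  have RE: "E v w" "E v x" if "R v w x" for v w x
    using that edge_of_facet_edge_of by (auto simp: E_def R_def)
  have sq: "(v - c) \<bullet> (v - c) = r\<^sup>2" if "v \<in> V" for v
    using that circ unfolding circumscribed_sphere_def V_def
    by (auto simp: dist_norm norm_minus_commute simp flip: power2_norm_eq_inner)
  have len: "(v - c) \<bullet> (w - c) = r\<^sup>2 - s\<^sup>2 / 2" if "v \<in> V" "w \<in> V" "E v w" for v w
  proof -
    have "{F. F facet_of P \<and> closed_segment v w edge_of F} \<noteq> {}"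
      using edge_in_two_facets[OF P, of "closed_segment v w"] that(3)
      by (metis E_def card.empty zero_neq_numeral)
    then have "dist v w = s" using s by blast
    then show ?thesis
      using sq[OF that(1)] sq[OF that(2)] dot_norm_neg[of "v - c" "w - c"]
      by (simp add: dist_norm power2_norm_eq_inner field_simps)
  qed
  \<comment> \<open>The corner at \<open>v\<close> has inner product \<open>k\<close>; moving the
    origin from \<open>v\<close> to \<open>c\<close> adds twice the value in \<open>len\<close> and
    subtracts \<open>r\<^sup>2\<close>.\<close>
  have ang: "(w - c) \<bullet> (x - c) = k + r\<^sup>2 - s\<^sup>2" if vwx: "v \<in> V" "w \<in> V" "x \<in> V" "R v w x" for v w x
  proof -
    have "(w - v) \<bullet> (x - v) = k" using k vwx(4) unfolding R_def by metis
    moreover have "(w - v) \<bullet> (x - v) = (w - c) \<bullet> (x - c) - (v - c) \<bullet> (w - c) - (v - c) \<bullet> (x - c) + (v - c) \<bullet> (v - c)"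
      by (simp add: inner_diff inner_commute)
    ultimately show ?thesis using len[OF _ _ RE(1)] len[OF _ _ RE(2)] vwx sq by simp
  qed
  \<comment> \<open>Some vertex lies in some facet, so \<open>q\<close> is positive and vertices
    have neighbours.\<close>
  obtain v0 where v0: "v0 extreme_point_of P"
  proof (rule extreme_point_exists_convex[of P])
    show "compact P" "convex P" "P \<noteq> {}"
      using P polytope_imp_compact polytope_imp_convex by auto
  qed
  have "{v0} \<noteq> P" using P(2) by auto
  then obtain F0 where "F0 facet_of P" "v0 \<in> F0"
    using face_of_polyhedron_subset_facet[OF ph, of "{v0}"] v0 by (auto simp: face_of_singleton)
  moreover have "finite {F. F facet_of P \<and> v0 \<in> F}"
    using finite_polyhedron_facets[OF ph] by (rule rev_finite_subset) auto
  ultimately have qpos: "q > 0" using q[OF v0] card_gt_0_iff by blast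
  have "DIM(real^3) = 3" by simp
  moreover have "finite V" unfolding V_def by (rule finite_polyhedron_extreme_points[OF ph])
  moreover have "inj_on (\<lambda>v. v - c) V" by (auto simp: inj_on_def)
  moreover have "E w v" if "E v w" for v w using that by (simp add: E_def closed_segment_commute)
  moreover have "card {w\<in>V. E v w} = q" if "v \<in> V" for v
  proof -
    have "{w\<in>V. E v w} = {w. closed_segment v w edge_of P}" using EV by (auto simp: E_def)
    then show ?thesis using card_edges_eq_card_facets_at_vertex[OF P] q that by (simp add: V_def)
  qed
  moreover have "card {x\<in>V. E v x \<and> R v w x} = 2" if "E v w" for v w
  proof -
    have "{x\<in>V. E v x \<and> R v w x} = {x. R v w x}" using RE EV by blast
    then show ?thesis using two_face_neighbours[OF P, of v w] that by (simp add: E_def R_def)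
  qed
  moreover have "R v x w" if "R v w x" for v w x using that by (auto simp: R_def)
  moreover note sq len ang qpos
  ultimately have "(\<Sum>v\<in>V. v - c) = 0 \<and> (\<Sum>v\<in>V. ((v - c) \<bullet> z)\<^sup>2) = card V * r\<^sup>2 * (z \<bullet> z) / 3"
    by (intro conjI regular_configuration_moments[of V "\<lambda>v. v - c" "r\<^sup>2" E q "r\<^sup>2 - s\<^sup>2 / 2" R "k + r\<^sup>2 - s\<^sup>2"])
  then show "(\<Sum>v\<in>V. v - c) = 0" "(\<Sum>v\<in>V. ((v - c) \<bullet> z)\<^sup>2) = card V * r\<^sup>2 * (z \<bullet> z) / 3"
    by auto
qed

text \<open>The squared distance from \<open>M\<close> is affine in \<open>v - c\<close>, so the
  first two moments determine both power sums: \<open>2 * n * r\<^sup>2\<close> and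
  \<open>16 / 3 * n * r ^ 4\<close>.\<close>

theorem theorem7p6:
  fixes P :: "(real^3) set" and A :: "nat \<Rightarrow> real^3" and n :: nat
    and c M :: "real^3" and r :: real
  assumes "platonic_solid P"
    and "bij_betw A {1..n} {v. v extreme_point_of P}"
    and "circumscribed_sphere P c r"
    and "M \<in> sphere c r"
  shows "4 * (\<Sum>i=1..n. dist M (A i) ^ 2) ^ 2 = 3 * real n * (\<Sum>i=1..n. dist M (A i) ^ 4)"
proof -
  define V where "V = {v. v extreme_point_of P}"
  define m where "m = M - c"
  have re: "(\<Sum>i=1..n. f (A i)) = sum f V" for f :: "real^3 \<Rightarrow> real"
    using sum.reindex_bij_betw[OF assms(2)] by (simp add: V_def)
  have n: "real n = card V" using bij_betw_same_card[OF assms(2)] by (simp add: V_def)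
  have mm: "m \<bullet> m = r\<^sup>2"
    using assms(4) by (auto simp: m_def dist_norm norm_minus_commute simp flip: power2_norm_eq_inner)
  \<comment> \<open>Law of cosines in the triangle \<open>c\<close>, \<open>M\<close>,
    \<open>v\<close>, with both sides at \<open>c\<close> of squared length
    \<open>r\<^sup>2\<close>.\<close>
  have d: "(dist M v)\<^sup>2 = 2 * r\<^sup>2 - 2 * ((v - c) \<bullet> m)" if "v \<in> V" for v
  proof -
    have "(v - c) \<bullet> (v - c) = r\<^sup>2"
      using that assms(3) unfolding circumscribed_sphere_def V_def
      by (auto simp: dist_norm norm_minus_commute simp flip: power2_norm_eq_inner)
    moreover have "(dist M v)\<^sup>2 = m \<bullet> m + (v - c) \<bullet> (v - c) - 2 * ((v - c) \<bullet> m)"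
      by (simp add: m_def dist_norm power2_norm_eq_inner inner_diff inner_commute)
    ultimately show ?thesis using mm by simp
  qed
  have zero: "(\<Sum>v\<in>V. (v - c) \<bullet> m) = 0"
    using platonic_solid_vertex_moments(1)[OF assms(1,3)]
    by (simp add: V_def inner_sum_left[symmetric])
  \<comment> \<open>The second moment in direction \<open>m\<close>, whose own squared length
    \<open>r\<^sup>2\<close> supplies the other factor of \<open>r ^ 4\<close>.\<close>
  have sq: "(\<Sum>v\<in>V. ((v - c) \<bullet> m)\<^sup>2) = real n * r ^ 4 / 3"
    using platonic_solid_vertex_moments(2)[OF assms(1,3), of m] mm n
    by (simp add: V_def power4_eq_xxxx power2_eq_square)
  have s2: "(\<Sum>v\<in>V. (dist M v)\<^sup>2) = 2 * real n * r\<^sup>2"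
    using zero by (simp add: d sum_subtractf sum_distrib_left[symmetric] n)
  have "(\<Sum>v\<in>V. dist M v ^ 4) = (\<Sum>v\<in>V. 4 * r ^ 4 - 8 * r\<^sup>2 * ((v - c) \<bullet> m) + 4 * ((v - c) \<bullet> m)\<^sup>2)"
  proof (rule sum.cong[OF refl])
    fix v assume "v \<in> V"
    then have "dist M v ^ 4 = (2 * r\<^sup>2 - 2 * ((v - c) \<bullet> m))\<^sup>2" by (simp flip: d)
    then show "dist M v ^ 4 = 4 * r ^ 4 - 8 * r\<^sup>2 * ((v - c) \<bullet> m) + 4 * ((v - c) \<bullet> m)\<^sup>2"
      by (simp add: power2_diff power_mult_distrib)
  qed
  also have "\<dots> = 4 * real n * r ^ 4 + 4 * (real n * r ^ 4 / 3)"
    by (simp add: sum.distrib sum_subtractf sum_distrib_left[symmetric] zero sq n)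
  finally have s4: "(\<Sum>v\<in>V. dist M v ^ 4) = 16 / 3 * real n * r ^ 4" by simp
  show ?thesis
    unfolding re[of "\<lambda>v. (dist M v)\<^sup>2"] re[of "\<lambda>v. dist M v ^ 4"] s2 s4
    by (simp add: power2_eq_square power4_eq_xxxx)
qed

end
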